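(* Let $n\geq0$ and let $\alpha_0,\alpha_1,\ldots,\alpha_m$ be integers with $\alpha_0\geq0$, $\alpha_i>0$ for $i=1,\ldots,m$, and $\sum_{i=0}^m\alpha_i=n$. Then $$K[\alpha_0+1,\alpha_1,\ldots,\alpha_{m-1},\alpha_m+1]\leq K[1^n,2]=K[2,1^n]=F_{n+1},$$ with equality if and only if either $m=n$, $\alpha_0=0$ and $\alpha_1=\cdots=\alpha_n=1$, or $m=n-1$ and $\alpha_0=\alpha_1=\cdots=\alpha_{n-1}=1$. (For $m=0$ the left-hand side is interpreted as $K[\alpha_0+2]$.)
   Context: Continuants are defined by $K[\,]=1$, $K[a_0]=a_0$, and $K[a_0,\ldots,a_n]=a_nK[a_0,\ldots,a_{n-1}]+K[a_0,\ldots,a_{n-2}]$ for $n\geq1$. $1^n$ denotes the sequence $(1,\ldots,1)$ of length $n$. Fibonacci numbers: $F_{-1}=F_0=1$, $F_{n+1}=F_n+F_{n-1}$ for $n\geq0$. *)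

theory Defs
  imports Main "HOL-Number_Theory.Fib"
begin

function continuant :: "int list \<Rightarrow> int" where
  "continuant [] = 1"
| "continuant [a] = a"
| "continuant (as @ [a, b]) = b * continuant (as @ [a]) + continuant as"
proof -
  fix P :: bool and xs :: "int list"
  assume nil: "xs = [] \<Longrightarrow> P" and single: "\<And>a. xs = [a] \<Longrightarrow> P"
    and step: "\<And>as a b. xs = as @ [a, b] \<Longrightarrow> P"
  show P
  proof (cases xs rule: rev_cases)
    case Nil
    then show P by (rule nil)
  next
    case (snoc ys b)
    show P
    proof (cases ys rule: rev_cases)
      case Nil
      with snoc show P by (auto intro: single)
    next
      case (snoc as a)
      with \<open>xs = ys @ [b]\<close> show P by (auto intro: step)
    qed
  qed
qed auto
termination by (relation "measure length") auto

text \<open>Fibonacci numbers with \<open>F\<^sub>-\<^sub>1 = F\<^sub>0 = 1\<close>. This is the library sequence \<open>fib\<close>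
  (\<open>fib 0 = 0\<close>, \<open>fib 1 = 1\<close>) shifted by two places; arguments below \<open>-1\<close> are
  irrelevant.\<close>

definition F :: "int \<Rightarrow> int" where
  "F k = int (fib (nat (k + 2)))"

lemma F_minus_one: "F (-1) = 1"
  by (simp add: F_def)

lemma F_zero: "F 0 = 1"
  by (simp add: F_def numeral_2_eq_2)

lemma F_rec:
  assumes "k \<ge> 0"
  shows "F (k + 1) = F k + F (k - 1)"
proof -
  have "nat (k + 1 + 2) = Suc (Suc (nat (k - 1 + 2)))" "nat (k + 2) = Suc (nat (k - 1 + 2))"
    using assms by linarith+
  then show ?thesis
    by (simp add: F_def)
qed

text \<open>The sequence \<open>\<alpha>\<^sub>0 + 1, \<alpha>\<^sub>1, \<dots>, \<alpha>\<^sub>m\<^sub>-\<^sub>1, \<alpha>\<^sub>m + 1\<close>. For \<open>m = 0\<close> both increments fall on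
  the single entry.\<close>

definition incr_ends :: "nat \<Rightarrow> (nat \<Rightarrow> int) \<Rightarrow> int list" where
  "incr_ends m \<alpha> =
     (if m = 0 then [\<alpha> 0 + 2] else [\<alpha> 0 + 1] @ map \<alpha> [1..<m] @ [\<alpha> m + 1])"

end

(* Since K[1, a, ...] = K[a + 1, ...], and symmetrically at the right end, the continuant in
   question is K[1, x_1, ..., x_k, 1], where the x_i are the alpha_i with a possible zero alpha_0
   dropped. Expanding at the left end gives K[1, x, xs, 1] = K[1, xs, 1] + x K[xs, 1], which
   is at most F_{s+1} + x F_s, s being the sum of xs, by induction. This is at most F_{s+x+1},
   with equality only for x = 1. *)

theory Submission
  imports Defs
begin

lemma continuant_snoc2:
  "continuant (as @ [a, b]) = b * continuant (as @ [a]) + continuant as"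
  by (rule continuant.simps(3))

lemma continuant_pair: "continuant [a, b] = b * a + 1"
  using continuant_snoc2[of "[]" a b] by simp

text \<open>Expansion at the left end agrees with the defining expansion at the right end: as
  functions of \<open>xs\<close>, both sides satisfy the same recurrence at the right, so induction
  along that recurrence reduces the claim to lists of length at most one.\<close>

lemma continuant_Cons2:
  "continuant (a # b # xs) = a * continuant (b # xs) + continuant xs"
proof (induction xs rule: continuant.induct)
  case 1
  then show ?case by (simp add: continuant_pair)
next
  case (2 c)
  then show ?case
    using continuant_snoc2[of "[a]" b c] by (simp add: continuant_pair algebra_simps)
next
  case (3 as c d)
  have "continuant (a # b # as @ [c, d]) =
      d * continuant (a # b # as @ [c]) + continuant (a # b # as)"
    using continuant_snoc2[of "a # b # as" c d] by simp
  moreover have "continuant (b # as @ [c, d]) =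
      d * continuant (b # as @ [c]) + continuant (b # as)"
    using continuant_snoc2[of "b # as" c d] by simp
  ultimately show ?case
    using 3 by (simp add: continuant_snoc2 algebra_simps)
qed

lemma continuant_one_Cons: "continuant (1 # a # xs) = continuant ((a + 1) # xs)"
  by (cases xs) (simp_all add: continuant_pair continuant_Cons2 algebra_simps)

lemma continuant_snoc_one: "continuant (as @ [a, 1]) = continuant (as @ [a + 1])"
proof (cases as rule: rev_cases)
  case Nil
  then show ?thesis by (simp add: continuant_pair)
next
  case (snoc bs b)
  then show ?thesis
    using continuant_snoc2[of bs b a] continuant_snoc2[of bs b "a + 1"]
      continuant_snoc2[of as a 1]
    by (simp add: algebra_simps)
qed

text \<open>A zero entry merges its two neighbours into their sum, here 1 + y, and K[1 + y, ...] =
  K[1, y, ...].\<close>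

lemma continuant_one_zero_Cons: "continuant (1 # 0 # y # ys) = continuant (1 # y # ys)"
  by (simp add: continuant_Cons2)

text \<open>Separate end entries 1 absorb the convention for \<open>m = 0\<close>, since K[1, a, 1]
  = a + 2, and they leave the \<alpha> unchanged, so that bounds can be stated through their
  sum.\<close>

lemma continuant_incr_ends:
  "continuant (incr_ends m \<alpha>) = continuant (1 # map \<alpha> [0..<Suc m] @ [1])"
proof (cases "m = 0")
  case True
  then show ?thesis
    by (simp add: incr_ends_def continuant_Cons2 continuant_pair)
next
  case False
  then have "[0..<Suc m] = 0 # [1..<m] @ [m]"
    by (simp add: upt_conv_Cons)
  then have "continuant (1 # map \<alpha> [0..<Suc m] @ [1]) =
      continuant ((\<alpha> 0 + 1) # map \<alpha> [1..<m] @ [\<alpha> m, 1])"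
    by (simp add: continuant_one_Cons)
  also have "\<dots> = continuant (incr_ends m \<alpha>)"
    using False continuant_snoc_one[of "(\<alpha> 0 + 1) # map \<alpha> [1..<m]" "\<alpha> m"]
    by (simp add: incr_ends_def)
  finally show ?thesis by simp
qed

lemma continuant_incr_ends_zero:
  assumes "\<alpha> 0 = 0"
  shows "continuant (incr_ends m \<alpha>) = continuant (1 # map \<alpha> [1..<Suc m] @ [1])"
proof -
  \<comment> \<open>The trailing 1 guarantees an entry after the zero, even for
    \<open>m = 0\<close>.\<close>
  obtain y ys where ys: "map \<alpha> [1..<Suc m] @ [1] = y # ys"
    by (metis append_is_Nil_conv list.exhaust not_Cons_self2)
  have "map \<alpha> [0..<Suc m] = 0 # map \<alpha> [1..<Suc m]"
    using assms upt_conv_Cons[of 0 "Suc m"] by simp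
  then show ?thesis
    using ys by (simp add: continuant_incr_ends continuant_one_zero_Cons
        del: upt_Suc map_append)
qed

lemma F_pos:
  assumes "k \<ge> -1"
  shows "F k > 0"
  using assms by (simp add: F_def fib_neq_0_nat)

text \<open>Each step from k to k + 1 adds F(k - 1) > 0. The start must be at least 0 because F(-1)
  = F(0).\<close>

lemma F_less:
  assumes "0 \<le> s" and "1 \<le> x"
  shows "F s < F (s + x)"
  using assms(2)
proof (induction x rule: int_ge_induct)
  case base
  show ?case using F_rec[of s] F_pos[of "s - 1"] assms(1) by simp
next
  case (step x)
  then show ?case
    using F_rec[of "s + x"] F_pos[of "s + x - 1"] assms(1) by (simp add: add.assoc)
qed

text \<open>For x = 1 this is the Fibonacci recurrence. Raising x by one adds F(s) on the left but
  the larger F(s + x) on the right, so the inequality is strict from x = 2 on.\<close>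

lemma F_combination_bound:
  assumes "0 \<le> s" and "1 \<le> x"
  shows "F (s + 1) + x * F s \<le> F (s + x + 1)"
    and "F (s + 1) + x * F s = F (s + x + 1) \<longleftrightarrow> x = 1"
proof -
  have eq: "F (s + 1) + 1 * F s = F (s + 1 + 1)"
    using F_rec[of "s + 1"] assms(1) by simp
  have less: "F (s + 1) + x * F s < F (s + x + 1)" if "2 \<le> x" for x
    using that
  proof (induction x rule: int_ge_induct)
    case base
    have "F (s + 2 + 1) = F (s + 2) + F (s + 1)"
      using F_rec[of "s + 2"] assms(1) by (simp add: add_ac)
    then show ?case
      using eq F_less[of s 1] assms(1) by (simp add: add_ac)
  next
    case (step x)
    then show ?case
      using F_rec[of "s + x + 1"] F_less[of s x] assms(1) by (simp add: algebra_simps)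
  qed
  show "F (s + 1) + x * F s \<le> F (s + x + 1)"
    using eq less[of x] assms(2) by (cases "x = 1") auto
  show "F (s + 1) + x * F s = F (s + x + 1) \<longleftrightarrow> x = 1"
    using eq less[of x] assms(2) by (cases "x = 1") auto
qed

lemma continuant_positive_bound:
  assumes "\<forall>x\<in>set xs. 1 \<le> x"
  shows "continuant (xs @ [1]) \<le> F (sum_list xs)"
    and "continuant (1 # xs @ [1]) \<le> F (sum_list xs + 1)"
    and "continuant (1 # xs @ [1]) = F (sum_list xs + 1) \<longleftrightarrow> (\<forall>x\<in>set xs. x = 1)"
proof -
  \<comment> \<open>Expanding K[1, x, xs, 1] involves both K[1, xs, 1] and K[xs, 1], so both are
    bounded in one induction. The fourth conjunct supplies the value of K[xs, 1] needed to show that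
    all ones attain the bound.\<close>
  have "continuant (xs @ [1]) \<le> F (sum_list xs)
    \<and> continuant (1 # xs @ [1]) \<le> F (sum_list xs + 1)
    \<and> (continuant (1 # xs @ [1]) = F (sum_list xs + 1) \<longleftrightarrow> (\<forall>x\<in>set xs. x = 1))
    \<and> ((\<forall>x\<in>set xs. x = 1) \<longrightarrow> continuant (xs @ [1]) = F (sum_list xs))"
    using assms
  proof (induction xs)
    case Nil
    then show ?case
      using F_rec[of 0] by (simp add: continuant_pair F_zero F_minus_one)
  next
    case (Cons x xs)
    define s where "s = sum_list xs"
    define k where "k = continuant (xs @ [1])"
    define q where "q = continuant (1 # xs @ [1])"
    have x: "1 \<le> x" and s: "0 \<le> s"
      using Cons.prems by (auto simp: s_def intro!: sum_list_nonneg)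
    have IH: "k \<le> F s" "q \<le> F (s + 1)"
      "q = F (s + 1) \<longleftrightarrow> (\<forall>x\<in>set xs. x = 1)"
      "(\<forall>x\<in>set xs. x = 1) \<Longrightarrow> k = F s"
      using Cons by (auto simp: s_def k_def q_def)
    \<comment> \<open>The tail continuant K[ys] in K[x, y, ys] = x k + K[ys] is eliminated by q = k
      + K[ys], leaving only quantities controlled by the induction hypothesis.\<close>
    have k': "continuant (x # xs @ [1]) = q + (x - 1) * k"
    proof -
      obtain y ys where "xs @ [1] = y # ys"
        by (cases "xs @ [1]") auto
      then show ?thesis
        by (simp add: q_def k_def continuant_Cons2 algebra_simps)
    qed
    then have q': "continuant (1 # x # xs @ [1]) = q + x * k"
      by (simp add: continuant_Cons2 k_def algebra_simps)
    have "q + (x - 1) * k \<le> F (s + 1) + (x - 1) * F s"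
      using IH x by (intro add_mono mult_left_mono) auto
    \<comment> \<open>The combination bound applies with x - 1 in place of x; x = 1 is separate, as
      it would give the excluded multiplier 0.\<close>
    also have "\<dots> \<le> F (s + x)"
      using F_combination_bound(1)[of s "x - 1"] s x by (cases "x = 1") auto
    finally have 1: "continuant (x # xs @ [1]) \<le> F (s + x)"
      using k' by simp
    have xk: "x * k \<le> x * F s"
      using IH x by (intro mult_left_mono) auto
    note comb = F_combination_bound[OF s x]
    have 2: "continuant (1 # x # xs @ [1]) \<le> F (s + x + 1)"
      using q' xk IH(2) comb(1) by linarith
    have 3: "continuant (1 # x # xs @ [1]) = F (s + x + 1) \<longleftrightarrow> (\<forall>y\<in>set (x # xs). y = 1)"
    proof
      assume "continuant (1 # x # xs @ [1]) = F (s + x + 1)"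
      \<comment> \<open>Equality at the ends of q + x k \<le> F(s + 1) + x F(s) \<le> F(s + x + 1)
        makes every estimate in between tight.\<close>
      then have "q = F (s + 1)" "F (s + 1) + x * F s = F (s + x + 1)"
        using q' xk IH(2) comb(1) by linarith+
      then show "\<forall>y\<in>set (x # xs). y = 1"
        using comb(2) IH(3) by simp
    next
      assume "\<forall>y\<in>set (x # xs). y = 1"
      then show "continuant (1 # x # xs @ [1]) = F (s + x + 1)"
        using q' IH(3,4) comb(2) by simp
    qed
    have 4: "(\<forall>y\<in>set (x # xs). y = 1) \<longrightarrow> continuant (x # xs @ [1]) = F (s + x)"
      using k' IH(3) by (simp add: q_def s_def)
    show ?case
      using 1 2 3 4 by (simp add: s_def add_ac)
  qed
  then show "continuant (xs @ [1]) \<le> F (sum_list xs)"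
    and "continuant (1 # xs @ [1]) \<le> F (sum_list xs + 1)"
    and "continuant (1 # xs @ [1]) = F (sum_list xs + 1) \<longleftrightarrow> (\<forall>x\<in>set xs. x = 1)"
    by auto
qed

lemma continuant_ones: "continuant (1 # replicate n 1 @ [1]) = F (int n + 1)"
  using continuant_positive_bound(3)[of "replicate n 1"] by (simp add: sum_list_replicate)

text \<open>In a list of n + 2 ones, contracting the first two gives 2 followed by n ones.\<close>

lemma continuant_two_ones: "continuant (2 # replicate n 1) = F (int n + 1)"
  using continuant_ones[of n] continuant_one_Cons[of 1 "replicate n 1"]
    replicate_append_same[of n "1 :: int"] by simp

lemma continuant_ones_two: "continuant (replicate n 1 @ [2]) = F (int n + 1)"
  using continuant_ones[of n] continuant_snoc_one[of "replicate n 1" 1]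
    replicate_append_same[of n "1 :: int"]
  by (metis append_Cons append_Nil append_assoc one_add_one)

theorem theorem5p3:
  fixes n m :: nat and \<alpha> :: "nat \<Rightarrow> int"
  assumes "\<alpha> 0 \<ge> 0"
    and "\<forall>i\<in>{1..m}. \<alpha> i > 0"
    and "(\<Sum>i=0..m. \<alpha> i) = int n"
  shows "continuant (incr_ends m \<alpha>) \<le> continuant (replicate n 1 @ [2])
    \<and> continuant (replicate n 1 @ [2]) = continuant (2 # replicate n 1)
    \<and> continuant (2 # replicate n 1) = F (int n + 1)
    \<and> (continuant (incr_ends m \<alpha>) = F (int n + 1) \<longleftrightarrow>
         (m = n \<and> \<alpha> 0 = 0 \<and> (\<forall>i\<in>{1..n}. \<alpha> i = 1))
       \<or> (int m = int n - 1 \<and> (\<forall>i\<in>{0..m}. \<alpha> i = 1)))"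
proof -
  have "continuant (incr_ends m \<alpha>) \<le> F (int n + 1)
    \<and> (continuant (incr_ends m \<alpha>) = F (int n + 1) \<longleftrightarrow>
         (m = n \<and> \<alpha> 0 = 0 \<and> (\<forall>i\<in>{1..n}. \<alpha> i = 1))
       \<or> (int m = int n - 1 \<and> (\<forall>i\<in>{0..m}. \<alpha> i = 1)))"
  \<comment> \<open>Each case yields one of the two equality alternatives: a zero at the front is
    dropped, leaving m positive entries; otherwise all m + 1 entries are positive.\<close>
  proof (cases "\<alpha> 0 = 0")
    case True
    define xs where "xs = map \<alpha> [1..<Suc m]"
    have set_xs: "set xs = \<alpha> ` {1..m}"
      by (auto simp: xs_def simp del: upt_Suc)
    have sum: "(\<Sum>i=1..m. \<alpha> i) = int n"
      using assms(3) True by (simp add: sum.atLeast_Suc_atMost)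
    have sum_xs: "sum_list xs = int n"
      using sum by (simp add: xs_def interv_sum_list_conv_sum_set_nat
          atLeastLessThanSuc_atLeastAtMost del: upt_Suc)
    \<comment> \<open>Here m ones sum to n, so the ranges up to m and up to n in the equality
      condition coincide.\<close>
    have len: "m = n" if "\<forall>i\<in>{1..m}. \<alpha> i = 1"
      using sum that by simp
    have pos: "\<forall>x\<in>set xs. 1 \<le> x"
      using assms(2) by (auto simp: set_xs)
    have "continuant (incr_ends m \<alpha>) = continuant (1 # xs @ [1])"
      unfolding xs_def by (rule continuant_incr_ends_zero[of \<alpha> m, OF True])
    then have "continuant (incr_ends m \<alpha>) \<le> F (int n + 1)"
      and "continuant (incr_ends m \<alpha>) = F (int n + 1) \<longleftrightarrow> (\<forall>i\<in>{1..m}. \<alpha> i = 1)"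
      using continuant_positive_bound(2,3)[OF pos] by (simp_all add: set_xs sum_xs)
    moreover have "\<not> (\<forall>i\<in>{0..m}. \<alpha> i = 1)"
      using True by (metis atLeastAtMost_iff le0 zero_neq_one)
    ultimately show ?thesis
      using len True by blast
  next
    case False
    define xs where "xs = map \<alpha> [0..<Suc m]"
    have set_xs: "set xs = \<alpha> ` {0..m}"
      by (auto simp: xs_def simp del: upt_Suc)
    have sum_xs: "sum_list xs = int n"
      using assms(3) by (simp add: xs_def interv_sum_list_conv_sum_set_nat
          atLeastLessThanSuc_atLeastAtMost del: upt_Suc)
    \<comment> \<open>Now m + 1 ones sum to n, as the entry at index 0 is counted too.\<close>
    have len: "int m = int n - 1" if "\<forall>i\<in>{0..m}. \<alpha> i = 1"
      using assms(3) that by simp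
    have "1 \<le> \<alpha> i" if "i \<le> m" for i
      using assms(1) False bspec[OF assms(2), of i] that by (cases "i = 0") auto
    then have pos: "\<forall>x\<in>set xs. 1 \<le> x"
      by (auto simp: set_xs)
    have "continuant (incr_ends m \<alpha>) = continuant (1 # xs @ [1])"
      unfolding xs_def by (rule continuant_incr_ends)
    then have "continuant (incr_ends m \<alpha>) \<le> F (int n + 1)"
      and "continuant (incr_ends m \<alpha>) = F (int n + 1) \<longleftrightarrow> (\<forall>i\<in>{0..m}. \<alpha> i = 1)"
      using continuant_positive_bound(2,3)[OF pos] by (simp_all add: set_xs sum_xs)
    then show ?thesis
      using len False by blast
  qed
  then show ?thesis
    by (simp add: continuant_two_ones continuant_ones_two)
qed

end
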